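(* The map $\min:\mathbf{COrd}\times\mathbf{COrd}\to\mathbf{COrd}$, $(\alpha,\beta)\mapsto\min\{\alpha,\beta\}$, is computable.
   Context: A represented space is a pair $(X,\delta_X)$ with $\delta_X:\subseteq\mathbb{N}^\mathbb{N}\to X$ a partial surjection; a function between represented spaces is computable if some computable $F:\subseteq\mathbb{N}^\mathbb{N}\to\mathbb{N}^\mathbb{N}$ maps names of inputs to names of outputs. Products are represented via a standard pairing $\langle p,q\rangle$. $\mathbf{COrd}=(\mathrm{cord},\delta_{\mathrm{nK}})$ is the set of countable ordinals with the representation defined inductively by $\delta_{\mathrm{nK}}(0p)=0$, $\delta_{\mathrm{nK}}(1p)=\delta_{\mathrm{nK}}(p)+1$, $\delta_{\mathrm{nK}}(2\langle p_0,p_1,\ldots\rangle)=\sup_{i}\delta_{\mathrm{nK}}(p_i)$, where $\langle p_0,p_1,\ldots\rangle$ is a standard computable tupling on $\mathbb{N}^\mathbb{N}$. *)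

theory Defs
  imports
    "HOL-Library.Countable_Set"
    "HOL-Library.Nat_Bijection"
begin

section \<open>The countable ordinals\<close>

unbundle cardinal_syntax

lemma Well_order_empty: "Well_order {}"
  by (simp add: order_on_defs Field_def refl_on_def)

text \<open>
  A countable ordinal is the order type of a well-order whose field is some subset of \<open>\<nat>\<close>
  (finite and empty fields included).  As \<open>=o\<close> only relates well-orders, it is a partial
  equivalence on all relations.
\<close>

quotient_type cord = "nat rel" / partial: "\<lambda>r s. r =o s"
proof (rule part_equivpI)
  show "\<exists>r :: nat rel. r =o r"
    using ordIso_reflexive[OF Well_order_empty] by blast
  show "symp (\<lambda>r s :: nat rel. r =o s)"
    by (auto intro: sympI ordIso_symmetric)
  show "transp (\<lambda>r s :: nat rel. r =o s)"
    by (auto intro: transpI ordIso_transitive)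
qed

lemma rep_cord_iso: "rep_cord \<alpha> =o rep_cord \<alpha>"
  using Quotient_rep_reflp[OF Quotient_cord] .

lemma Well_order_rep_cord: "Well_order (rep_cord \<alpha>)"
  using rep_cord_iso unfolding ordIso_def by blast

lemma abs_cord_rep_cord: "abs_cord (rep_cord \<alpha>) = \<alpha>"
  using Quotient_abs_rep[OF Quotient_cord] .

lemma rep_cord_abs_cord: "Well_order r \<Longrightarrow> rep_cord (abs_cord r) =o r"
  using Quotient_rep_abs[OF Quotient_cord, of r] ordIso_reflexive by blast

lemma cord_eq_iff: "\<alpha> = \<beta> \<longleftrightarrow> rep_cord \<alpha> =o rep_cord \<beta>"
  using Quotient_rel_rep[OF Quotient_cord, of \<alpha> \<beta>] by simp

instantiation cord :: linorder
begin

lift_definition less_eq_cord :: "cord \<Rightarrow> cord \<Rightarrow> bool" is "\<lambda>r s. r \<le>o s"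
  by (meson ordIso_ordLeq_trans ordIso_symmetric ordLeq_ordIso_trans)

lift_definition less_cord :: "cord \<Rightarrow> cord \<Rightarrow> bool" is "\<lambda>r s. r <o s"
  by (meson ordIso_ordLess_trans ordIso_symmetric ordLess_ordIso_trans)

lemma less_eq_cord_rep: "\<alpha> \<le> \<beta> \<longleftrightarrow> rep_cord \<alpha> \<le>o rep_cord \<beta>"
  by (simp add: less_eq_cord_def)

lemma less_cord_rep: "\<alpha> < \<beta> \<longleftrightarrow> rep_cord \<alpha> <o rep_cord \<beta>"
  by (simp add: less_cord_def)

instance
proof
  fix \<alpha> \<beta> \<gamma> :: cord
  show "\<alpha> < \<beta> \<longleftrightarrow> \<alpha> \<le> \<beta> \<and> \<not> \<beta> \<le> \<alpha>"
    unfolding less_cord_rep less_eq_cord_rep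
    using not_ordLeq_iff_ordLess[OF Well_order_rep_cord Well_order_rep_cord] ordLess_imp_ordLeq
    by blast
  show "\<alpha> \<le> \<alpha>"
    unfolding less_eq_cord_rep by (rule ordLeq_reflexive[OF Well_order_rep_cord])
  show "\<alpha> \<le> \<beta> \<Longrightarrow> \<beta> \<le> \<gamma> \<Longrightarrow> \<alpha> \<le> \<gamma>"
    unfolding less_eq_cord_rep by (rule ordLeq_transitive)
  show "\<alpha> \<le> \<beta> \<Longrightarrow> \<beta> \<le> \<alpha> \<Longrightarrow> \<alpha> = \<beta>"
    unfolding less_eq_cord_rep cord_eq_iff ordIso_iff_ordLeq by simp
  show "\<alpha> \<le> \<beta> \<or> \<beta> \<le> \<alpha>"
    unfolding less_eq_cord_rep by (rule ordLeq_total[OF Well_order_rep_cord Well_order_rep_cord])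
qed

end

instance cord :: wellorder
proof
  fix P :: "cord \<Rightarrow> bool" and \<alpha>
  assume step: "\<And>\<alpha>. (\<And>\<beta>. \<beta> < \<alpha> \<Longrightarrow> P \<beta>) \<Longrightarrow> P \<alpha>"
  have "wf (inv_image ordLess rep_cord)"
    by (rule wf_inv_image[OF wf_ordLess])
  then show "P \<alpha>"
  proof (induction \<alpha> rule: wf_induct_rule)
    case (less \<alpha>)
    then show ?case by (rule step) (simp add: less_cord_rep)
  qed
qed

instantiation cord :: conditionally_complete_linorder
begin

definition inf_cord :: "cord \<Rightarrow> cord \<Rightarrow> cord" where "inf_cord = min"
definition sup_cord :: "cord \<Rightarrow> cord \<Rightarrow> cord" where "sup_cord = max"
definition Inf_cord :: "cord set \<Rightarrow> cord" where "Inf_cord A = (LEAST \<alpha>. \<alpha> \<in> A)"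
definition Sup_cord :: "cord set \<Rightarrow> cord" where "Sup_cord A = (LEAST \<beta>. \<forall>\<alpha>\<in>A. \<alpha> \<le> \<beta>)"

instance
proof
  fix \<alpha> \<beta> \<gamma> :: cord and A :: "cord set"
  show "\<alpha> \<in> A \<Longrightarrow> bdd_below A \<Longrightarrow> Inf A \<le> \<alpha>"
    unfolding Inf_cord_def by (rule Least_le)
  show "A \<noteq> {} \<Longrightarrow> (\<And>\<alpha>. \<alpha> \<in> A \<Longrightarrow> \<beta> \<le> \<alpha>) \<Longrightarrow> \<beta> \<le> Inf A"
    unfolding Inf_cord_def using LeastI_ex[of "\<lambda>\<alpha>. \<alpha> \<in> A"] by blast
  show "\<alpha> \<in> A \<Longrightarrow> bdd_above A \<Longrightarrow> \<alpha> \<le> Sup A"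
    unfolding Sup_cord_def bdd_above_def
    using LeastI_ex[of "\<lambda>\<beta>. \<forall>\<alpha>\<in>A. \<alpha> \<le> \<beta>"] by blast
  show "A \<noteq> {} \<Longrightarrow> (\<And>\<alpha>. \<alpha> \<in> A \<Longrightarrow> \<alpha> \<le> \<beta>) \<Longrightarrow> Sup A \<le> \<beta>"
    unfolding Sup_cord_def by (rule Least_le) blast
qed (auto simp: inf_cord_def sup_cord_def)

end

instantiation cord :: zero
begin

definition zero_cord :: cord where "0 = abs_cord {}"

instance ..

end

lemma zero_cord_le: "0 \<le> (\<alpha> :: cord)"
proof -
  have "rep_cord 0 =o ({} :: nat rel)"
    unfolding zero_cord_def by (rule rep_cord_abs_cord[OF Well_order_empty])
  moreover have "({} :: nat rel) \<le>o rep_cord \<alpha>"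
    using Well_order_empty Well_order_rep_cord
    unfolding ordLeq_def embed_def by auto
  ultimately show ?thesis
    unfolding less_eq_cord_rep by (rule ordIso_ordLeq_trans)
qed

text \<open>
  The next facts show that suprema of sequences and successors always exist in \<^typ>\<open>cord\<close>,
  so that \<^const>\<open>Sup\<close> and \<open>LEAST\<close> below have their intended meaning.
\<close>

lemma less_abs_cord_iff:
  assumes "Well_order r"
  shows "\<beta> < abs_cord r \<longleftrightarrow> (\<exists>a\<in>Field r. \<beta> = abs_cord (Restr r (underS r a)))"
proof -
  have "\<beta> < abs_cord r \<longleftrightarrow> rep_cord \<beta> <o r"
    unfolding less_cord_rep
    using rep_cord_abs_cord[OF assms] ordIso_symmetric ordLess_ordIso_trans by blast
  also have "\<dots> \<longleftrightarrow> (\<exists>a\<in>Field r. rep_cord \<beta> =o Restr r (underS r a))"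
    by (rule ordLess_iff_ordIso_Restr[OF assms Well_order_rep_cord])
  also have "\<dots> \<longleftrightarrow> (\<exists>a\<in>Field r. \<beta> = abs_cord (Restr r (underS r a)))"
    using rep_cord_abs_cord[OF Well_order_Restr[OF assms]] ordIso_symmetric ordIso_transitive
    unfolding cord_eq_iff by blast
  finally show ?thesis .
qed

lemma countable_lessThan_cord: "countable {..<\<alpha> :: cord}"
proof -
  have "{..<\<alpha>} \<subseteq> range (\<lambda>a. abs_cord (Restr (rep_cord \<alpha>) (underS (rep_cord \<alpha>) a)))"
    using less_abs_cord_iff[OF Well_order_rep_cord, of _ \<alpha>] by (auto simp: abs_cord_rep_cord)
  then show ?thesis
    by (rule countable_subset) simp
qed

lemma countable_cord_strictly_bounded:
  assumes "countable A"
  shows "\<exists>\<gamma> :: cord. \<forall>\<alpha>\<in>A. \<alpha> < \<gamma>"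
proof -
  define B where "B = (\<Union>\<alpha>\<in>A. insert \<alpha> {..<\<alpha>})"
  have B_iff: "\<beta> \<in> B \<longleftrightarrow> (\<exists>\<alpha>\<in>A. \<beta> \<le> \<alpha>)" for \<beta>
    unfolding B_def by (auto simp: order_le_less)
  have down: "\<beta> \<in> B" if "\<alpha> \<in> B" "\<beta> < \<alpha>" for \<alpha> \<beta>
    using that B_iff by (meson order.strict_implies_order order.trans)
  have "countable B"
    unfolding B_def using assms countable_lessThan_cord by auto
  then obtain g :: "cord \<Rightarrow> nat" where g: "inj_on g B"
    unfolding countable_def by blast
  define r where "r = {(g \<alpha>, g \<beta>) | \<alpha> \<beta>. \<alpha> \<in> B \<and> \<beta> \<in> B \<and> \<alpha> \<le> \<beta>}"
  have r_iff: "(g \<alpha>, g \<beta>) \<in> r \<longleftrightarrow> \<alpha> \<le> \<beta>" if "\<alpha> \<in> B" "\<beta> \<in> B" for \<alpha> \<beta>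
  proof
    assume "(g \<alpha>, g \<beta>) \<in> r"
    then obtain \<alpha>' \<beta>' where *: "g \<alpha> = g \<alpha>'" "g \<beta> = g \<beta>'" "\<alpha>' \<in> B" "\<beta>' \<in> B" "\<alpha>' \<le> \<beta>'"
      unfolding r_def by blast
    have "\<alpha> = \<alpha>'" "\<beta> = \<beta>'"
      by (rule inj_onD[OF g *(1) that(1) *(3)], rule inj_onD[OF g *(2) that(2) *(4)])
    with * show "\<alpha> \<le> \<beta>" by simp
  qed (use that in \<open>auto simp: r_def\<close>)
  have r_cases: "\<exists>\<alpha>\<in>B. \<exists>\<beta>\<in>B. x = g \<alpha> \<and> y = g \<beta>" if "(x, y) \<in> r" for x y
    using that unfolding r_def by blast
  have field: "Field r = g ` B"
    unfolding r_def Field_def by auto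
  have wf: "wf (r - Id)"
  proof (rule wfI_min)
    fix x and Q :: "nat set"
    assume x: "x \<in> Q"
    show "\<exists>z\<in>Q. \<forall>y. (y, z) \<in> r - Id \<longrightarrow> y \<notin> Q"
    proof (cases "\<exists>\<beta>\<in>B. g \<beta> \<in> Q")
      case True
      define \<beta> where "\<beta> = (LEAST \<beta>. \<beta> \<in> B \<and> g \<beta> \<in> Q)"
      have \<beta>: "\<beta> \<in> B \<and> g \<beta> \<in> Q"
        unfolding \<beta>_def using True LeastI_ex[of "\<lambda>\<beta>. \<beta> \<in> B \<and> g \<beta> \<in> Q"] by blast
      have "y \<notin> Q" if y: "(y, g \<beta>) \<in> r" "y \<noteq> g \<beta>" for y
      proof
        assume "y \<in> Q"
        from r_cases[OF y(1)] obtain \<delta> where \<delta>: "\<delta> \<in> B" "y = g \<delta>" by blast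
        have "\<delta> \<le> \<beta>" using y(1) \<delta> \<beta> r_iff by simp
        moreover have "\<beta> \<le> \<delta>"
          unfolding \<beta>_def using \<delta> \<open>y \<in> Q\<close> by (simp add: Least_le)
        ultimately show False using y(2) \<delta>(2) by simp
      qed
      with \<beta> show ?thesis by blast
    next
      case False
      with x r_cases show ?thesis by blast
    qed
  qed
  have wo: "Well_order r"
    unfolding well_order_on_def linear_order_on_def partial_order_on_def preorder_on_def
  proof (intro conjI wf)
    show "refl_on (Field r) r" unfolding field refl_on_def by (auto simp: r_iff)
    show "r \<subseteq> Field r \<times> Field r" by (auto simp: Field_def)
    show "trans r" 
    proof (rule transI)
      fix x y z assume xy: "(x, y) \<in> r" and yz: "(y, z) \<in> r"
      from r_cases[OF xy] obtain \<alpha> where \<alpha>: "\<alpha> \<in> B" "x = g \<alpha>" by blast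
      from r_cases[OF yz] obtain \<beta> \<gamma> where \<beta>: "\<beta> \<in> B" "\<gamma> \<in> B" "y = g \<beta>" "z = g \<gamma>" by blast
      have "\<alpha> \<le> \<beta>" "\<beta> \<le> \<gamma>" using xy yz \<alpha> \<beta> r_iff by auto
      then have "\<alpha> \<le> \<gamma>" by (rule order.trans)
      then show "(x, z) \<in> r" using \<alpha> \<beta> r_iff by auto
    qed
    show "antisym r" 
    proof (rule antisymI)
      fix x y assume xy: "(x, y) \<in> r" and yx: "(y, x) \<in> r"
      from r_cases[OF xy] obtain \<alpha> \<beta> where \<alpha>: "\<alpha> \<in> B" "\<beta> \<in> B" "x = g \<alpha>" "y = g \<beta>" by blast
      then have "\<alpha> = \<beta>" using xy yx r_iff by (auto intro: order.antisym)
      with \<alpha> show "x = y" by simp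
    qed
    show "total_on (Field r) r" unfolding field total_on_def by (auto simp: r_iff)
  qed
  have underS: "underS r (g \<beta>) = g ` {..<\<beta>}" if "\<beta> \<in> B" for \<beta>
  proof (intro set_eqI iffI)
    fix x assume "x \<in> underS r (g \<beta>)"
    then have x: "x \<noteq> g \<beta>" "(x, g \<beta>) \<in> r" by (auto simp: underS_def)
    then obtain \<delta> where "x = g \<delta>" "\<delta> \<in> B" unfolding r_def by blast
    with x r_iff[OF _ that] show "x \<in> g ` {..<\<beta>}" by (auto simp: order_less_le)
  next
    fix x assume "x \<in> g ` {..<\<beta>}"
    then obtain \<delta> where \<delta>: "x = g \<delta>" "\<delta> < \<beta>" by blast
    then have "\<delta> \<in> B" using down that by blast
    with \<delta> that r_iff[of \<delta> \<beta>] inj_onD[OF g, of \<delta> \<beta>] show "x \<in> underS r (g \<beta>)"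
      by (auto simp: underS_def)
  qed
  have type: "abs_cord (Restr r (underS r (g \<beta>))) = \<beta>" if "\<beta> \<in> B" for \<beta>
    using that
  proof (induction \<beta> rule: less_induct)
    case (less \<beta>)
    let ?s = "Restr r (underS r (g \<beta>))"
    have sub: "{..<\<beta>} \<subseteq> B" using down less.prems by blast
    have fs: "Field ?s = g ` {..<\<beta>}"
      using sub unfolding underS[OF less.prems] Field_def by (force simp: r_iff)
    have rs: "Restr ?s (underS ?s (g \<delta>)) = Restr r (underS r (g \<delta>))" if "\<delta> < \<beta>" for \<delta>
    proof -
      have "\<delta> \<in> B" using that sub by blast
      have "underS ?s (g \<delta>) = underS r (g \<delta>)"
        using that underS[OF less.prems] underS[OF \<open>\<delta> \<in> B\<close>]
        by (auto simp: underS_def)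
      moreover have "underS r (g \<delta>) \<subseteq> underS r (g \<beta>)"
        unfolding underS[OF less.prems] underS[OF \<open>\<delta> \<in> B\<close>] using that by auto
      ultimately show ?thesis by blast
    qed
    have IH: "abs_cord (Restr r (underS r (g \<delta>))) = \<delta>" if "\<delta> < \<beta>" for \<delta>
      using less.IH[OF that] sub that by blast
    have "\<gamma> < abs_cord ?s \<longleftrightarrow> \<gamma> < \<beta>" for \<gamma>
    proof -
      have "\<gamma> < abs_cord ?s \<longleftrightarrow> (\<exists>\<delta><\<beta>. \<gamma> = abs_cord (Restr r (underS r (g \<delta>))))"
        unfolding less_abs_cord_iff[OF Well_order_Restr[OF wo]] fs using rs by auto
      also have "\<dots> \<longleftrightarrow> (\<exists>\<delta><\<beta>. \<gamma> = \<delta>)"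
        by (intro ex_cong1 conj_cong) (simp_all add: IH)
      finally show ?thesis by simp
    qed
    then show ?case
      by (metis linorder_neqE order.irrefl)
  qed
  have "\<alpha> < abs_cord r" if "\<alpha> \<in> A" for \<alpha>
  proof -
    have "\<alpha> \<in> B" using that unfolding B_def by blast
    then have "g \<alpha> \<in> Field r" unfolding field by blast
    with type[OF \<open>\<alpha> \<in> B\<close>] show ?thesis unfolding less_abs_cord_iff[OF wo] by metis
  qed
  then show ?thesis by blast
qed

lemma bdd_above_range_cord: "bdd_above (range (f :: nat \<Rightarrow> cord))"
  using countable_cord_strictly_bounded[of "range f"] unfolding bdd_above_def
  by (meson countableI_type countable_image order.strict_implies_order)

definition succ_cord :: "cord \<Rightarrow> cord" where
  "succ_cord \<alpha> = (LEAST \<beta>. \<alpha> < \<beta>)"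

lemma less_succ_cord: "\<alpha> < succ_cord \<alpha>"
  unfolding succ_cord_def
  using countable_cord_strictly_bounded[of "{\<alpha>}"] by (auto intro: LeastI_ex)

lemma succ_cord_le_iff: "succ_cord \<alpha> \<le> \<beta> \<longleftrightarrow> \<alpha> < \<beta>"
  using less_succ_cord[of \<alpha>] Least_le[of "\<lambda>\<beta>. \<alpha> < \<beta>" \<beta>]
  unfolding succ_cord_def by (auto intro: order.strict_trans2)


section \<open>Computability on Baire space\<close>

type_synonym baire = "nat \<Rightarrow> nat"

text \<open>
  Partial recursive functions relative to an oracle: \<open>computes p e xs y\<close> says that
  the program \<open>e\<close>, run with oracle \<open>p\<close> on the arguments \<open>xs\<close>, halts with value \<open>y\<close>.
\<close>

datatype prog =
    Zero
  | Succ
  | Proj nat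
  | Oracle
  | Comp prog "prog list"
  | PrimRec prog prog
  | Mu prog

inductive computes :: "baire \<Rightarrow> prog \<Rightarrow> nat list \<Rightarrow> nat \<Rightarrow> bool" for p :: baire where
  Zero: "computes p Zero xs 0"
| Succ: "computes p Succ [x] (Suc x)"
| Proj: "i < length xs \<Longrightarrow> computes p (Proj i) xs (xs ! i)"
| Oracle: "computes p Oracle [x] (p x)"
| Comp: "list_all2 (\<lambda>g y. computes p g xs y) gs ys \<Longrightarrow> computes p f ys z
    \<Longrightarrow> computes p (Comp f gs) xs z"
| PrimRec_0: "computes p f xs y \<Longrightarrow> computes p (PrimRec f g) (0 # xs) y"
| PrimRec_Suc: "computes p (PrimRec f g) (n # xs) y \<Longrightarrow> computes p g (n # y # xs) z
    \<Longrightarrow> computes p (PrimRec f g) (Suc n # xs) z"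
| Mu: "computes p f (n # xs) 0 \<Longrightarrow> \<forall>m<n. \<exists>y>0. computes p f (m # xs) y
    \<Longrightarrow> computes p (Mu f) xs n"

inductive_cases computes_elims:
  "computes p Zero xs z"
  "computes p Succ xs z"
  "computes p (Proj i) xs z"
  "computes p Oracle xs z"
  "computes p (Comp f gs) xs z"
  "computes p (PrimRec f g) (0 # xs) z"
  "computes p (PrimRec f g) (Suc n # xs) z"
  "computes p (Mu f) xs z"

lemma computes_deterministic: "computes p e xs y \<Longrightarrow> computes p e xs z \<Longrightarrow> y = z"
proof (induction arbitrary: z rule: computes.induct)
  case (Zero xs)
  then show ?case by (blast elim: computes_elims(1))
next
  case (Succ x)
  then show ?case by (auto elim!: computes_elims(2))
next
  case (Proj i xs)
  then show ?case by (auto elim!: computes_elims(3))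
next
  case (Oracle x)
  then show ?case by (auto elim!: computes_elims(4))
next
  case (Comp xs gs ys f w)
  from Comp.prems obtain ys' where
    ys': "list_all2 (\<lambda>g y. computes p g xs y) gs ys'" "computes p f ys' z"
    by (rule computes_elims(5))
  have "ys = ys'"
    using Comp.IH(1) ys'(1) by (auto simp: list_all2_conv_all_nth intro!: nth_equalityI)
  then show ?case using Comp.IH(2) ys'(2) by blast
next
  case (PrimRec_0 f xs y g)
  from PrimRec_0.prems have "computes p f xs z" by (rule computes_elims(6))
  then show ?case by (rule PrimRec_0.IH)
next
  case (PrimRec_Suc f g n xs y w)
  from PrimRec_Suc.prems obtain y' where
    "computes p (PrimRec f g) (n # xs) y'" "computes p g (n # y' # xs) z"
    by (rule computes_elims(7))
  then show ?case using PrimRec_Suc.IH by blast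
next
  case (Mu f n xs)
  from Mu.prems have z: "computes p f (z # xs) 0" "\<forall>m<z. \<exists>y>0. computes p f (m # xs) y"
    by (blast elim: computes_elims(8))+
  show ?case
  proof (cases n z rule: linorder_cases)
    case less
    then show ?thesis using z(2) Mu.IH(1) by blast
  next
    case greater
    then show ?thesis using z(1) Mu.IH(2) by fastforce
  qed
qed

text \<open>
  A partial function on Baire space is computable if one program produces, uniformly in
  \<open>p\<close> from its domain, the \<open>n\<close>-th value of the output from the oracle \<open>p\<close> and the input \<open>n\<close>.
  Nothing is required of the program outside the domain.
\<close>

definition computable_baire :: "(baire \<rightharpoonup> baire) \<Rightarrow> bool" where
  "computable_baire F \<longleftrightarrow> (\<exists>e. \<forall>p q. F p = Some q \<longrightarrow> (\<forall>n. computes p e [n] (q n)))"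


section \<open>Represented spaces\<close>

text \<open>
  A representation is a partial map on Baire space; surjectivity onto the underlying
  set \<open>X\<close> says that its range is \<open>X\<close>.
\<close>

type_synonym 'a representation = "baire \<rightharpoonup> 'a"

definition represented_space :: "'a set \<Rightarrow> 'a representation \<Rightarrow> bool" where
  "represented_space X \<delta> \<longleftrightarrow> ran \<delta> = X"

definition computable_map ::
  "'a representation \<Rightarrow> 'b representation \<Rightarrow> ('a \<Rightarrow> 'b) \<Rightarrow> bool" where
  "computable_map \<delta>X \<delta>Y f \<longleftrightarrow>
     (\<exists>F. computable_baire F \<and>
       (\<forall>p x. \<delta>X p = Some x \<longrightarrow> (\<exists>q. F p = Some q \<and> \<delta>Y q = Some (f x))))"

definition baire_pair :: "baire \<Rightarrow> baire \<Rightarrow> baire" where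
  "baire_pair p q n = (if even n then p (n div 2) else q (n div 2))"

definition baire_fst :: "baire \<Rightarrow> baire" where "baire_fst r n = r (2 * n)"
definition baire_snd :: "baire \<Rightarrow> baire" where "baire_snd r n = r (2 * n + 1)"

lemma baire_fst_pair [simp]: "baire_fst (baire_pair p q) = p"
  by (auto simp: baire_fst_def baire_pair_def)

lemma baire_snd_pair [simp]: "baire_snd (baire_pair p q) = q"
  by (auto simp: baire_snd_def baire_pair_def)

lemma baire_pair_fst_snd [simp]: "baire_pair (baire_fst r) (baire_snd r) = r"
  by (rule ext) (auto simp: baire_fst_def baire_snd_def baire_pair_def elim!: evenE oddE)

definition prod_rep :: "'a representation \<Rightarrow> 'b representation \<Rightarrow> ('a \<times> 'b) representation" where
  "prod_rep \<delta>X \<delta>Y r =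
     (case (\<delta>X (baire_fst r), \<delta>Y (baire_snd r)) of (Some x, Some y) \<Rightarrow> Some (x, y) | _ \<Rightarrow> None)"

lemma prod_rep_pair:
  "prod_rep \<delta>X \<delta>Y (baire_pair p q) = Some (x, y) \<longleftrightarrow> \<delta>X p = Some x \<and> \<delta>Y q = Some y"
  by (simp add: prod_rep_def split: option.splits)

lemma represented_space_prod:
  assumes "represented_space X \<delta>X" "represented_space Y \<delta>Y"
  shows "represented_space (X \<times> Y) (prod_rep \<delta>X \<delta>Y)"
proof -
  have "(x, y) \<in> ran (prod_rep \<delta>X \<delta>Y) \<longleftrightarrow> x \<in> ran \<delta>X \<and> y \<in> ran \<delta>Y" for x y
    unfolding ran_def using prod_rep_pair[of \<delta>X \<delta>Y _ _ x y]
    by clarsimp (metis baire_pair_fst_snd)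
  with assms show ?thesis unfolding represented_space_def by auto
qed


section \<open>The representation of the countable ordinals\<close>

definition baire_cons :: "nat \<Rightarrow> baire \<Rightarrow> baire" where
  "baire_cons a p n = (case n of 0 \<Rightarrow> a | Suc m \<Rightarrow> p m)"

text \<open>\<^const>\<open>prod_decode\<close> is the inverse of the Cantor pairing function.\<close>

definition baire_tuple :: "(nat \<Rightarrow> baire) \<Rightarrow> baire" where
  "baire_tuple P n = (case prod_decode n of (i, m) \<Rightarrow> P i m)"

lemma baire_cons_inject [simp]: "baire_cons a p = baire_cons b q \<longleftrightarrow> a = b \<and> p = q"
proof
  assume eq: "baire_cons a p = baire_cons b q"
  have "a = b" using fun_cong[OF eq, of 0] by (simp add: baire_cons_def)
  moreover have "p n = q n" for n using fun_cong[OF eq, of "Suc n"] by (simp add: baire_cons_def)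
  ultimately show "a = b \<and> p = q" by blast
qed simp

lemma baire_tuple_encode [simp]: "baire_tuple P (prod_encode (i, m)) = P i m"
  by (simp add: baire_tuple_def)

lemma baire_tuple_inject [simp]: "baire_tuple P = baire_tuple Q \<longleftrightarrow> P = Q"
proof
  assume eq: "baire_tuple P = baire_tuple Q"
  have "P i m = Q i m" for i m using fun_cong[OF eq, of "prod_encode (i, m)"] by simp
  then show "P = Q" by blast
qed simp

inductive nK_name :: "baire \<Rightarrow> cord \<Rightarrow> bool" where
  zero: "nK_name (baire_cons 0 p) 0"
| succ: "nK_name p \<alpha> \<Longrightarrow> nK_name (baire_cons 1 p) (succ_cord \<alpha>)"
| lim: "(\<And>i. nK_name (P i) (f i)) \<Longrightarrow> nK_name (baire_cons 2 (baire_tuple P)) (SUP i. f i)"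

lemma nK_name_unique: "nK_name p \<alpha> \<Longrightarrow> nK_name p \<beta> \<Longrightarrow> \<alpha> = \<beta>"
proof (induction arbitrary: \<beta> rule: nK_name.induct)
  case (zero p)
  then show ?case by (auto elim: nK_name.cases)
next
  case (succ p \<alpha>)
  from succ.prems show ?case by (cases rule: nK_name.cases) (auto dest: succ.IH)
next
  case (lim P f)
  from lim.prems show ?case
  proof (cases rule: nK_name.cases)
    case (lim Q g)
    then have "f i = g i" for i using lim.IH by auto
    with lim show ?thesis by presburger
  qed auto
qed

definition \<delta>_nK :: "cord representation" where
  "\<delta>_nK p = (if \<exists>\<alpha>. nK_name p \<alpha> then Some (THE \<alpha>. nK_name p \<alpha>) else None)"

lemma \<delta>_nK_eq_Some_iff: "\<delta>_nK p = Some \<alpha> \<longleftrightarrow> nK_name p \<alpha>"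
proof -
  have "(THE \<alpha>. nK_name p \<alpha>) = \<beta>" if "nK_name p \<beta>" for \<beta>
    using that nK_name_unique by blast
  then show ?thesis unfolding \<delta>_nK_def by auto
qed

lemma represented_space_cord: "represented_space UNIV \<delta>_nK"
proof -
  have "\<exists>p. nK_name p \<alpha>" for \<alpha>
  proof (induction \<alpha> rule: less_induct)
    case (less \<alpha>)
    show ?case
    proof (cases "\<alpha> = 0")
      case True
      then show ?thesis using nK_name.zero by blast
    next
      case False
      then have ne: "{..<\<alpha>} \<noteq> {}"
        using zero_cord_le[of \<alpha>] by (metis empty_iff lessThan_iff order_le_less)
      then obtain f :: "nat \<Rightarrow> cord" where f: "range f = {..<\<alpha>}"
        using range_from_nat_into[OF ne countable_lessThan_cord] by blast
      then have "\<exists>p. nK_name p (f i)" for i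
        using less.IH by blast
      then obtain P where "\<And>i. nK_name (P i) (f i)" by metis
      then have "nK_name (baire_cons 2 (baire_tuple (\<lambda>i. baire_cons 1 (P i))))
          (SUP i. succ_cord (f i))"
        by (intro nK_name.lim nK_name.succ)
      moreover have "(SUP i. succ_cord (f i)) = \<alpha>"
      proof (rule order.antisym)
        show "(SUP i. succ_cord (f i)) \<le> \<alpha>"
          by (rule cSUP_least) (use f in \<open>auto simp: succ_cord_le_iff\<close>)
        show "\<alpha> \<le> (SUP i. succ_cord (f i))"
        proof (rule ccontr)
          assume "\<not> \<alpha> \<le> (SUP i. succ_cord (f i))"
          then obtain i where "f i = (SUP i. succ_cord (f i))"
            using f by (metis lessThan_iff not_le rangeE)
          moreover have "succ_cord (f i) \<le> (SUP i. succ_cord (f i))"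
            by (rule cSUP_upper[OF _ bdd_above_range_cord]) simp
          ultimately show False using less_succ_cord[of "f i"] by simp
        qed
      qed
      ultimately show ?thesis by auto
    qed
  qed
  then show ?thesis
    unfolding represented_space_def ran_def by (auto simp: \<delta>_nK_eq_Some_iff)
qed

end

theory Submission
  imports Defs
begin

text \<open>
  A name is a well-founded tree. The ordinals satisfy
  $\min(\alpha + 1, \beta + 1) = \min(\alpha, \beta) + 1$ and
  $\min(\sup_i \alpha_i, \beta) = \sup_i \min(\alpha_i, \beta)$, which by well-founded recursion
  turns names of $\alpha$ and $\beta$ into a name of the minimum. Computing the $n$-th symbol of
  this name descends along one branch of the two input trees. In every step the index decreases,
  so $n$ steps suffice. The current subtrees are given by their paths from the roots, from which
  one calculates where their symbols are located in the oracle; so all is primitive recursive.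
\<close>

section \<open>Minima of countable ordinals\<close>

text \<open>The successor is monotone, and a monotone map on a linear order commutes with
  minima.\<close>

lemma min_succ_cord: "min (succ_cord \<alpha>) (succ_cord \<beta>) = succ_cord (min \<alpha> \<beta>)"
proof -
  have "succ_cord \<gamma> \<le> succ_cord \<delta>" if "\<gamma> \<le> \<delta>" for \<gamma> \<delta>
    using that less_succ_cord[of \<delta>] by (simp add: succ_cord_le_iff)
  then show ?thesis
    by (metis linear min.absorb1 min.absorb2)
qed

text \<open>For the upper bound: if some \<open>f i\<close> reaches \<beta>, that member alone
  brings the right side up to \<beta>; otherwise every \<open>min (f i) \<beta>\<close> is just
  \<open>f i\<close>.\<close>

lemma min_SUP_cord: "min (SUP i. f i) \<beta> = (SUP i. min (f i) \<beta>)" for f :: "nat \<Rightarrow> cord"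
proof (rule order.antisym)
  have upper: "min (f i) \<beta> \<le> (SUP i. min (f i) \<beta>)" for i
    by (rule cSUP_upper[OF _ bdd_above_range_cord]) simp
  show "min (SUP i. f i) \<beta> \<le> (SUP i. min (f i) \<beta>)"
  proof (cases "\<exists>i. \<beta> \<le> f i")
    case True
    then obtain i where "\<beta> \<le> f i" by blast
    with upper[of i] show ?thesis by (simp add: min.absorb2 min.coboundedI2)
  next
    case False
    then have "min (f i) \<beta> = f i" for i by (simp add: min_absorb1 not_le order.strict_implies_order)
    then show ?thesis by simp
  qed
  show "(SUP i. min (f i) \<beta>) \<le> min (SUP i. f i) \<beta>"
    by (rule cSUP_least) (auto intro!: min.coboundedI1 cSUP_upper bdd_above_range_cord)
qed


section \<open>Names of minima\<close>

text \<open>Position, in a name, of symbol \<open>k\<close> of its child \<open>c\<close>. The outer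
  \<open>Suc\<close> skips the head symbol; \<open>c - 1\<close> is there because members of a
  supremum are numbered from 1 as children.\<close>

definition shift :: "nat \<Rightarrow> nat \<Rightarrow> nat" where
  "shift c k = Suc (if c = 0 then k else prod_encode (c - 1, k))"

text \<open>
  Child \<open>0\<close> of the name of a successor is the name of its predecessor; child \<open>i + 1\<close> of the
  name of a supremum is the name of its \<open>i\<close>-th member.
\<close>

definition child :: "nat \<Rightarrow> baire \<Rightarrow> baire" where
  "child c p k = p (shift c k)"

lemma baire_cons_0 [simp]: "baire_cons a p 0 = a"
  by (simp add: baire_cons_def)

lemma baire_cons_Suc [simp]: "baire_cons a p (Suc n) = p n"
  by (simp add: baire_cons_def)

lemma child_0_cons [simp]: "child 0 (baire_cons a p) = p"
  by (rule ext) (simp add: child_def shift_def)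

lemma child_Suc_cons [simp]: "child (Suc i) (baire_cons a (baire_tuple P)) = P i"
  by (rule ext) (simp add: child_def shift_def)

text \<open>All tests compare with 0, the form of branching covered by the closure rules below. For
  nonzero \<open>x\<close>, \<open>x - 1 = 0\<close> singles out the head 1; every larger head
  counts as a supremum.\<close>

definition min_head :: "nat \<Rightarrow> nat \<Rightarrow> nat" where
  "min_head x y =
    (if x = 0 then 0 else if y = 0 then 0 else
     if x - 1 = 0 then if y - 1 = 0 then 1 else 2 else 2)"

text \<open>The recursion runs on the index instead of the trees, so it terminates on arbitrary
  sequences, names or not. If both heads are nonzero, a supremum on the left is opened before one on
  the right.\<close>

function min_name :: "baire \<Rightarrow> baire \<Rightarrow> baire" where
  "min_name p q 0 = min_head (p 0) (q 0)"
| "min_name p q (Suc k) =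
    (if p 0 = 0 then 0 else if q 0 = 0 then 0 else
     if p 0 - 1 = 0 then
       if q 0 - 1 = 0 then min_name (child 0 p) (child 0 q) k
       else min_name p (child (Suc (fst (prod_decode k))) q) (snd (prod_decode k))
     else min_name (child (Suc (fst (prod_decode k))) p) q (snd (prod_decode k)))"
  by pat_completeness auto

lemma snd_prod_decode_le: "snd (prod_decode k) \<le> k"
  by (metis le_prod_encode_2 prod.collapse prod_decode_inverse)

termination min_name
  by (relation "measure (\<lambda>(p, q, n). n)") (auto simp: le_imp_less_Suc snd_prod_decode_le)

lemma min_name_zero:
  assumes "p 0 = 0 \<or> q 0 = 0"
  shows "min_name p q = baire_cons 0 (\<lambda>_. 0)"
proof
  fix n
  show "min_name p q n = baire_cons 0 (\<lambda>_. 0) n"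
    using assms by (cases n) (auto simp: min_head_def)
qed

lemma min_name_succ:
  "min_name (baire_cons 1 p) (baire_cons 1 q) = baire_cons 1 (min_name p q)"
proof
  fix n
  show "min_name (baire_cons 1 p) (baire_cons 1 q) n = baire_cons 1 (min_name p q) n"
    by (cases n) (auto simp: min_head_def)
qed

lemma min_name_lim_left:
  assumes "q 0 \<noteq> 0"
  shows "min_name (baire_cons 2 (baire_tuple P)) q =
    baire_cons 2 (baire_tuple (\<lambda>i. min_name (P i) q))"
proof
  fix n
  show "min_name (baire_cons 2 (baire_tuple P)) q n =
    baire_cons 2 (baire_tuple (\<lambda>i. min_name (P i) q)) n"
    using assms by (cases n) (auto simp: min_head_def baire_tuple_def split_beta)
qed

lemma min_name_lim_right:
  assumes "p 0 = 1"
  shows "min_name p (baire_cons 2 (baire_tuple Q)) =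
    baire_cons 2 (baire_tuple (\<lambda>i. min_name p (Q i)))"
proof
  fix n
  show "min_name p (baire_cons 2 (baire_tuple Q)) n =
    baire_cons 2 (baire_tuple (\<lambda>i. min_name p (Q i))) n"
    using assms by (cases n) (auto simp: min_head_def baire_tuple_def split_beta)
qed

lemma nK_name_head_0:
  assumes "nK_name p \<alpha>" "p 0 = 0"
  shows "\<alpha> = 0"
  using assms by cases auto

text \<open>Induction on the name of \<alpha>, with the right name arbitrary since successors are
  stripped on both sides at once.\<close>

lemma nK_name_min_name:
  assumes "nK_name p \<alpha>" "nK_name q \<beta>"
  shows "nK_name (min_name p q) (min \<alpha> \<beta>)"
  using assms
proof (induction arbitrary: q \<beta> rule: nK_name.induct)
  case (zero p)
  have "nK_name (min_name (baire_cons 0 p) q) 0"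
    by (simp add: min_name_zero nK_name.zero)
  then show ?case by (simp add: min_absorb1 zero_cord_le)
next
  case (succ p \<alpha>)
  note IH = succ.IH
  from succ.prems show ?case
  \<comment> \<open>The left name stays fixed while suprema on the right are opened, so the right
    name gets an induction of its own.\<close>
  proof (induction rule: nK_name.induct)
    case (zero q)
    have "nK_name (min_name (baire_cons 1 p) (baire_cons 0 q)) 0"
      by (simp add: min_name_zero nK_name.zero)
    then show ?case by (simp add: min_absorb2 zero_cord_le)
  next
    case (succ q \<beta>)
    then show ?case
      unfolding min_name_succ min_succ_cord by (intro nK_name.succ IH)
  next
    case (lim Q g)
    have "min (succ_cord \<alpha>) (SUP i. g i) = (SUP i. min (succ_cord \<alpha>) (g i))"
      using min_SUP_cord[of g "succ_cord \<alpha>"] by (simp add: min.commute)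
    with lim.IH show ?case by (simp add: min_name_lim_right nK_name.lim)
  qed
next
  case (lim P f)
  show ?case
  proof (cases "q 0 = 0")
    case True
    with lim.prems have "\<beta> = 0" by (blast dest: nK_name_head_0)
    with True show ?thesis
      by (simp add: min_name_zero nK_name.zero min_absorb2 zero_cord_le)
  next
    case False
    then show ?thesis
      using lim.IH lim.prems by (simp add: min_name_lim_left min_SUP_cord nK_name.lim)
  qed
qed


section \<open>Total functions computable relative to an oracle\<close>

text \<open>For total functions the closure rules carry no domain conditions; applied as
  introduction rules they assemble a program from the form of a term.\<close>

definition recursive :: "nat \<Rightarrow> (baire \<Rightarrow> nat list \<Rightarrow> nat) \<Rightarrow> bool" where
  "recursive k f \<longleftrightarrow> (\<exists>e. \<forall>p xs. length xs = k \<longrightarrow> computes p e xs (f p xs))"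

lemma recursiveI:
  "(\<And>p xs. length xs = k \<Longrightarrow> computes p e xs (f p xs)) \<Longrightarrow> recursive k f"
  unfolding recursive_def by blast

lemma recursiveE:
  assumes "recursive k f"
  obtains e where "\<And>p xs. length xs = k \<Longrightarrow> computes p e xs (f p xs)"
  using assms unfolding recursive_def by blast

named_theorems recursive_intros

lemma recursive_proj [recursive_intros]: "i < k \<Longrightarrow> recursive k (\<lambda>p xs. xs ! i)"
  by (rule recursiveI[where e = "Proj i"]) (simp add: computes.Proj)

lemma recursive_Suc [recursive_intros]:
  assumes "recursive k f"
  shows "recursive k (\<lambda>p xs. Suc (f p xs))"
proof -
  from assms obtain e where e: "\<And>p xs. length xs = k \<Longrightarrow> computes p e xs (f p xs)"
    by (rule recursiveE) blast
  show ?thesis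
    by (rule recursiveI[where e = "Comp Succ [e]"])
      (auto intro!: computes.Comp[where ys = "[_]"] computes.Succ e)
qed

lemma recursive_oracle [recursive_intros]:
  assumes "recursive k f"
  shows "recursive k (\<lambda>p xs. p (f p xs))"
proof -
  from assms obtain e where e: "\<And>p xs. length xs = k \<Longrightarrow> computes p e xs (f p xs)"
    by (rule recursiveE) blast
  show ?thesis
    by (rule recursiveI[where e = "Comp Oracle [e]"])
      (auto intro!: computes.Comp[where ys = "[_]"] computes.Oracle e)
qed

lemma recursive_const [recursive_intros]: "recursive k (\<lambda>p xs. c)"
proof (induction c)
  case 0
  show ?case by (rule recursiveI[where e = Zero]) (rule computes.Zero)
next
  case (Suc c)
  then show ?case by (rule recursive_Suc)
qed

text \<open>Weakening: the step function of a recursion finds its parameters behind two new arguments.\<close>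

lemma recursive_drop [recursive_intros]:
  assumes "recursive k f"
  shows "recursive (Suc (Suc k)) (\<lambda>p xs. f p (drop 2 xs))"
proof -
  from assms obtain e where e: "\<And>p xs. length xs = k \<Longrightarrow> computes p e xs (f p xs)"
    by (rule recursiveE) blast
  show ?thesis
  proof (rule recursiveI[where e = "Comp e (map (\<lambda>i. Proj (2 + i)) [0..<k])"])
    fix p and xs :: "nat list"
    assume len: "length xs = Suc (Suc k)"
    have "computes p (Proj (2 + i)) xs (drop 2 xs ! i)" if "i < k" for i
      using computes.Proj[of "2 + i" xs p] that len by simp
    then have "list_all2 (\<lambda>g y. computes p g xs y) (map (\<lambda>i. Proj (2 + i)) [0..<k]) (drop 2 xs)"
      using len by (simp add: list_all2_conv_all_nth)
    then show "computes p (Comp e (map (\<lambda>i. Proj (2 + i)) [0..<k])) xs (f p (drop 2 xs))"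
      by (rule computes.Comp) (simp add: e len)
  qed
qed

text \<open>\<open>PrimRec\<close> hands its step the counter, the previous value and then the
  parameters, hence \<open>xs ! 0\<close>, \<open>xs ! 1\<close> and
  \<open>drop 2 xs\<close>.\<close>

lemma recursive_rec_nat [recursive_intros]:
  assumes "recursive k n" "recursive k b"
    and "recursive (Suc (Suc k)) (\<lambda>p xs. s p (xs ! 0) (xs ! 1) (drop 2 xs))"
  shows "recursive k (\<lambda>p xs. rec_nat (b p xs) (\<lambda>i y. s p i y xs) (n p xs))"
proof -
  from assms(1) obtain en where en: "\<And>p xs. length xs = k \<Longrightarrow> computes p en xs (n p xs)"
    by (rule recursiveE) blast
  from assms(2) obtain eb where eb: "\<And>p xs. length xs = k \<Longrightarrow> computes p eb xs (b p xs)"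
    by (rule recursiveE) blast
  from assms(3) obtain es where es: "\<And>p xs. length xs = Suc (Suc k) \<Longrightarrow>
      computes p es xs (s p (xs ! 0) (xs ! 1) (drop 2 xs))"
    by (rule recursiveE) blast
  show ?thesis
  proof (rule recursiveI[where e = "Comp (PrimRec eb es) (en # map Proj [0..<k])"])
    fix p and xs :: "nat list"
    assume len: "length xs = k"
    have rec: "computes p (PrimRec eb es) (m # xs) (rec_nat (b p xs) (\<lambda>i y. s p i y xs) m)" for m
    proof (induction m)
      case 0
      then show ?case by (simp add: computes.PrimRec_0 eb len)
    next
      case (Suc m)
      then show ?case
        using es[of "m # _ # xs" p] len by (auto intro: computes.PrimRec_Suc)
    qed
    have "list_all2 (\<lambda>g y. computes p g xs y) (en # map Proj [0..<k]) (n p xs # xs)"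
      using len by (simp add: en) (simp add: list_all2_conv_all_nth computes.Proj)
    then show "computes p (Comp (PrimRec eb es) (en # map Proj [0..<k])) xs
        (rec_nat (b p xs) (\<lambda>i y. s p i y xs) (n p xs))"
      using rec by (rule computes.Comp)
  qed
qed

lemma funpow_rec_nat: "(F ^^ n) s = rec_nat s (\<lambda>_. F) n"
  by (induction n) auto

lemma recursive_funpow [recursive_intros]:
  assumes "recursive k n" "recursive k s"
    and "recursive (Suc (Suc k)) (\<lambda>p xs. F p (xs ! 1))"
  shows "recursive k (\<lambda>p xs. (F p ^^ n p xs) (s p xs))"
  unfolding funpow_rec_nat by (intro recursive_rec_nat assms)

lemma recursive_if [recursive_intros]:
  assumes "recursive k c" "recursive k f" "recursive k g"
  shows "recursive k (\<lambda>p xs. if c p xs = 0 then f p xs else g p xs)"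
proof -
  \<comment> \<open>A zero test is a recursion whose step ignores both the counter and the previous
    value.\<close>
  have "(if n = 0 then a else b) = rec_nat a (\<lambda>_ _. b) n" for n a b :: nat
    by (cases n) auto
  then show ?thesis by (simp only:) (intro recursive_intros assms)
qed

lemma recursive_add [recursive_intros]:
  assumes "recursive k f" "recursive k g"
  shows "recursive k (\<lambda>p xs. f p xs + g p xs)"
proof -
  have "a + n = rec_nat a (\<lambda>_. Suc) n" for a n
    by (induction n) auto
  then show ?thesis by (simp only:) (intro recursive_intros assms, simp)
qed

lemma recursive_diff [recursive_intros]:
  assumes "recursive k f" "recursive k g"
  shows "recursive k (\<lambda>p xs. f p xs - g p xs)"
proof -
  have pred: "n - 1 = rec_nat 0 (\<lambda>i _. i) n" for n
    by (cases n) auto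
  have diff: "a - n = rec_nat a (\<lambda>_ y. rec_nat 0 (\<lambda>i _. i) y) n" for a n
    by (induction n) (auto simp flip: pred)
  show ?thesis unfolding diff by (intro recursive_intros assms) simp_all
qed

lemma recursive_triangle [recursive_intros]:
  assumes "recursive k f"
  shows "recursive k (\<lambda>p xs. triangle (f p xs))"
proof -
  have "triangle n = rec_nat 0 (\<lambda>i y. y + Suc i) n" for n
    by (induction n) auto
  then show ?thesis by (simp only:) (intro recursive_intros assms, simp_all)
qed

lemma recursive_prod_encode [recursive_intros]:
  assumes "recursive k f" "recursive k g"
  shows "recursive k (\<lambda>p xs. prod_encode (f p xs, g p xs))"
  unfolding prod_encode_def prod.case by (intro recursive_intros assms)

text \<open>The largest \<open>y\<close> with \<open>triangle y \<le> n\<close>, raised by at most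
  one for each unit of \<open>n\<close>. The vanishing difference expresses
  \<open>triangle (Suc y) \<le> Suc i\<close>.\<close>

definition triangle_root :: "nat \<Rightarrow> nat" where
  "triangle_root n = rec_nat 0 (\<lambda>i y. if triangle (Suc y) - Suc i = 0 then Suc y else y) n"

lemma triangle_root_bounds:
  "triangle (triangle_root n) \<le> n \<and> n < triangle (Suc (triangle_root n))"
  by (induction n) (auto simp: triangle_root_def)

text \<open>Since \<open>prod_encode (a, b)\<close> is \<open>triangle (a + b) + a\<close> with
  \<open>a \<le> a + b\<close>, the root recovers \<open>a + b\<close> and the remainder is
  \<open>a\<close>.\<close>

lemma prod_decode_triangle_root:
  "prod_decode n =
    (n - triangle (triangle_root n), triangle_root n - (n - triangle (triangle_root n)))"
proof -
  have "prod_encode (n - triangle (triangle_root n),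
      triangle_root n - (n - triangle (triangle_root n))) = n"
    using triangle_root_bounds[of n] by (simp add: prod_encode_def)
  then show ?thesis by (metis prod_encode_inverse)
qed

lemma recursive_triangle_root [recursive_intros]:
  assumes "recursive k f"
  shows "recursive k (\<lambda>p xs. triangle_root (f p xs))"
  unfolding triangle_root_def by (intro recursive_intros assms) simp_all

lemma recursive_fst_prod_decode [recursive_intros]:
  assumes "recursive k f"
  shows "recursive k (\<lambda>p xs. fst (prod_decode (f p xs)))"
  unfolding prod_decode_triangle_root fst_conv by (intro recursive_intros assms)

lemma recursive_snd_prod_decode [recursive_intros]:
  assumes "recursive k f"
  shows "recursive k (\<lambda>p xs. snd (prod_decode (f p xs)))"
  unfolding prod_decode_triangle_root snd_conv by (intro recursive_intros assms)


section \<open>Locating subtrees\<close>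

text \<open>Paths list the child selected last first, so that descending is consing.\<close>

fun addr :: "nat list \<Rightarrow> nat \<Rightarrow> nat" where
  "addr [] k = k"
| "addr (c # cs) k = addr cs (shift c k)"

text \<open>One step of \<open>addr\<close> on a coded pair of path and offset, where
  \<open>list_encode (c # cs)\<close> is \<open>Suc (prod_encode (c, list_encode cs))\<close>. The
  empty path, coded by 0, is a fixed point, so surplus iterations do no harm.\<close>

definition pop :: "nat \<Rightarrow> nat" where
  "pop s = (if fst (prod_decode s) = 0 then s else
    prod_encode (snd (prod_decode (fst (prod_decode s) - 1)),
      shift (fst (prod_decode (fst (prod_decode s) - 1))) (snd (prod_decode s))))"

lemma pop_nil: "pop (prod_encode (list_encode [], k)) = prod_encode (list_encode [], k)"
  by (simp add: pop_def)

lemma pop_Cons: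
  "pop (prod_encode (list_encode (c # cs), k)) = prod_encode (list_encode cs, shift c k)"
  by (simp add: pop_def)

lemma funpow_pop:
  "length cs \<le> t \<Longrightarrow>
    (pop ^^ t) (prod_encode (list_encode cs, k)) = prod_encode (list_encode [], addr cs k)"
proof (induction t arbitrary: cs k)
  case (Suc t)
  then show ?case
    by (cases cs) (simp_all add: pop_nil pop_Cons funpow_Suc_right del: funpow.simps list_encode.simps)
qed simp

text \<open>This lets the code of a path serve as the number of iterations of
  \<open>pop\<close>.\<close>

lemma length_le_list_encode: "length cs \<le> list_encode cs"
proof (induction cs)
  case (Cons c cs)
  then show ?case using le_prod_encode_2[of "list_encode cs" c] by simp
qed simp

definition root_addr :: "nat \<Rightarrow> nat" where
  "root_addr l = snd (prod_decode ((pop ^^ l) (prod_encode (l, 0))))"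

lemma root_addr_list_encode: "root_addr (list_encode cs) = addr cs 0"
  by (simp add: root_addr_def funpow_pop length_le_list_encode)

lemma recursive_shift [recursive_intros]:
  assumes "recursive k f" "recursive k g"
  shows "recursive k (\<lambda>p xs. shift (f p xs) (g p xs))"
  unfolding shift_def by (intro recursive_intros assms)

lemma recursive_pop [recursive_intros]:
  assumes "recursive k f"
  shows "recursive k (\<lambda>p xs. pop (f p xs))"
  unfolding pop_def by (intro recursive_intros assms)

lemma recursive_root_addr [recursive_intros]:
  assumes "recursive k f"
  shows "recursive k (\<lambda>p xs. root_addr (f p xs))"
  unfolding root_addr_def by (intro recursive_intros assms) simp


section \<open>Computing the minimum\<close>

text \<open>
  A state \<open>(a, b, m)\<close> asks for symbol \<open>m\<close> of the minimum of the subtrees at the paths \<open>a\<close> and \<open>b\<close>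
  of the two components of the oracle.
\<close>

definition state_encode :: "nat \<Rightarrow> nat \<Rightarrow> nat \<Rightarrow> nat" where
  "state_encode a b m = prod_encode (a, prod_encode (b, m))"

definition left :: "nat \<Rightarrow> nat" where "left s = fst (prod_decode s)"
definition right :: "nat \<Rightarrow> nat" where "right s = fst (prod_decode (snd (prod_decode s)))"
definition index :: "nat \<Rightarrow> nat" where "index s = snd (prod_decode (snd (prod_decode s)))"

lemma state_encode_sel [simp]:
  "left (state_encode a b m) = a"
  "right (state_encode a b m) = b"
  "index (state_encode a b m) = m"
  by (simp_all add: state_encode_def left_def right_def index_def)

text \<open>The first component occupies the even positions of the oracle. Doubling is written as a
  sum to match the closure rule for addition.\<close>

definition left_head :: "baire \<Rightarrow> nat \<Rightarrow> nat" where
  "left_head r s = r (root_addr (left s) + root_addr (left s))"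

definition right_head :: "baire \<Rightarrow> nat \<Rightarrow> nat" where
  "right_head r s = r (Suc (root_addr (right s) + root_addr (right s)))"

definition push :: "nat \<Rightarrow> nat \<Rightarrow> nat" where
  "push c l = Suc (prod_encode (c, l))"

lemma push_list_encode: "push c (list_encode cs) = list_encode (c # cs)"
  by (simp add: push_def)

text \<open>One unfolding of \<open>min_name\<close> on coded states; index 0 marks a final state.
  At a zero head the index drops to 0 and the paths are kept, so that \<open>out_symbol\<close>
  reads this head again and yields 0.\<close>

definition step :: "baire \<Rightarrow> nat \<Rightarrow> nat" where
  "step r s =
    (if index s = 0 then s else
     if left_head r s = 0 then state_encode (left s) (right s) 0 else
     if right_head r s = 0 then state_encode (left s) (right s) 0 else
     if left_head r s - 1 = 0 then
       if right_head r s - 1 = 0 then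
         state_encode (push 0 (left s)) (push 0 (right s)) (index s - 1)
       else
         state_encode (left s) (push (Suc (fst (prod_decode (index s - 1)))) (right s))
           (snd (prod_decode (index s - 1)))
     else
       state_encode (push (Suc (fst (prod_decode (index s - 1)))) (left s)) (right s)
         (snd (prod_decode (index s - 1))))"

definition out_symbol :: "baire \<Rightarrow> nat \<Rightarrow> nat" where
  "out_symbol r s = min_head (left_head r s) (right_head r s)"

definition subtree :: "nat list \<Rightarrow> baire \<Rightarrow> baire" where
  "subtree cs p k = p (addr cs k)"

lemma subtree_Nil [simp]: "subtree [] p = p"
  by (rule ext) (simp add: subtree_def)

lemma child_subtree: "child c (subtree cs p) = subtree (c # cs) p"
  by (rule ext) (simp add: child_def subtree_def)

lemma left_head_state_encode:
  "left_head r (state_encode (list_encode a) b m) = subtree a (baire_fst r) 0"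
  by (simp add: left_head_def root_addr_list_encode subtree_def baire_fst_def mult_2)

lemma right_head_state_encode:
  "right_head r (state_encode a (list_encode b) m) = subtree b (baire_snd r) 0"
  by (simp add: right_head_def root_addr_list_encode subtree_def baire_snd_def mult_2)

text \<open>Each step lowers a positive index, and states of index 0 are fixed, so any number of
  steps from \<open>m\<close> on gives the symbol. Paths and index vary in the induction because a
  step changes them.\<close>

lemma out_symbol_funpow_step:
  "m \<le> t \<Longrightarrow>
    out_symbol r ((step r ^^ t) (state_encode (list_encode a) (list_encode b) m)) =
    min_name (subtree a (baire_fst r)) (subtree b (baire_snd r)) m"
proof (induction t arbitrary: a b m)
  case 0
  then show ?case
    by (simp add: out_symbol_def left_head_state_encode right_head_state_encode)
next
  case (Suc t)
  show ?case
  proof (cases m)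
    case 0
    then show ?thesis
      using Suc.IH[of 0 a b] by (simp add: step_def funpow_Suc_right del: funpow.simps)
  next
    case (Suc k)
    with Suc.prems have "k \<le> t" by simp
    moreover from this have "snd (prod_decode k) \<le> t"
      using snd_prod_decode_le order.trans by blast
    ultimately show ?thesis
      using Suc
      by (auto simp: step_def[of r "state_encode _ _ _"] funpow_Suc_right left_head_state_encode right_head_state_encode
          push_list_encode child_subtree Suc.IH min_head_def
          simp del: funpow.simps list_encode.simps)
  qed
qed

lemma recursive_state_encode [recursive_intros]:
  assumes "recursive k f" "recursive k g" "recursive k h"
  shows "recursive k (\<lambda>p xs. state_encode (f p xs) (g p xs) (h p xs))"
  unfolding state_encode_def by (intro recursive_intros assms)

lemma recursive_state_sel [recursive_intros]:
  assumes "recursive k f"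
  shows "recursive k (\<lambda>p xs. left (f p xs))"
    and "recursive k (\<lambda>p xs. right (f p xs))"
    and "recursive k (\<lambda>p xs. index (f p xs))"
  unfolding left_def right_def index_def by (intro recursive_intros assms)+

lemma recursive_head [recursive_intros]:
  assumes "recursive k f"
  shows "recursive k (\<lambda>p xs. left_head p (f p xs))"
    and "recursive k (\<lambda>p xs. right_head p (f p xs))"
  unfolding left_head_def right_head_def by (intro recursive_intros assms)+

lemma recursive_push [recursive_intros]:
  assumes "recursive k f" "recursive k g"
  shows "recursive k (\<lambda>p xs. push (f p xs) (g p xs))"
  unfolding push_def by (intro recursive_intros assms)

lemma recursive_step [recursive_intros]:
  assumes "recursive k f"
  shows "recursive k (\<lambda>p xs. step p (f p xs))"
  unfolding step_def by (intro recursive_intros assms)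

lemma recursive_out_symbol [recursive_intros]:
  assumes "recursive k f"
  shows "recursive k (\<lambda>p xs. out_symbol p (f p xs))"
  unfolding out_symbol_def min_head_def by (intro recursive_intros assms)

lemma recursive_min_name:
  "recursive 1 (\<lambda>r xs. min_name (baire_fst r) (baire_snd r) (xs ! 0))"
proof -
  \<comment> \<open>The descent starts at both roots, as 0 codes the empty path; the index
    \<open>n\<close> itself bounds the number of steps.\<close>
  have "min_name (baire_fst r) (baire_snd r) n = out_symbol r ((step r ^^ n) (state_encode 0 0 n))"
    for r n
    using out_symbol_funpow_step[of n n r "[]" "[]"] by simp
  then show ?thesis by (simp only:) (intro recursive_intros, simp_all)
qed

lemma computable_baire_min_name:
  "computable_baire (\<lambda>r. Some (min_name (baire_fst r) (baire_snd r)))"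
proof -
  from recursive_min_name obtain e where
    e: "\<And>r xs. length xs = 1 \<Longrightarrow>
      computes r e xs (min_name (baire_fst r) (baire_snd r) (xs ! 0))"
    by (rule recursiveE) blast
  have "computes r e [n] (min_name (baire_fst r) (baire_snd r) n)" for r n
    using e[of "[n]"] by simp
  then show ?thesis
    unfolding computable_baire_def by auto
qed

theorem theorem23:
  shows "computable_map (prod_rep \<delta>_nK \<delta>_nK) \<delta>_nK (\<lambda>(\<alpha>, \<beta>). min \<alpha> \<beta>)"
  unfolding computable_map_def
proof (intro exI conjI allI impI)
  show "computable_baire (\<lambda>r. Some (min_name (baire_fst r) (baire_snd r)))"
    by (rule computable_baire_min_name)
  fix r x
  assume "prod_rep \<delta>_nK \<delta>_nK r = Some x"
  then obtain \<alpha> \<beta> where "x = (\<alpha>, \<beta>)" "nK_name (baire_fst r) \<alpha>" "nK_name (baire_snd r) \<beta>"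
    by (auto simp: prod_rep_def \<delta>_nK_eq_Some_iff split: option.splits)
  then show "\<delta>_nK (min_name (baire_fst r) (baire_snd r)) = Some (case x of (\<alpha>, \<beta>) \<Rightarrow> min \<alpha> \<beta>)"
    by (simp add: \<delta>_nK_eq_Some_iff nK_name_min_name)
qed simp

end
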